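(* Let $\Gamma$ be a group acting on metric spaces $(X,d_X)$ and $(Y,d_Y)$, let $f:(X,d_X)\to(Y,d_Y)$ be a $\Gamma$-lipschitz-homotopy equivalence, let $g$ be a lipschitz-homotopy inverse of $f$ and $H$ a lipschitz homotopy between $g\circ f$ and $\mathrm{id}_X$. Then $f$ is uniformly proper.
   Context: $f_0\sim_\Gamma f_1$ means that $f_0,f_1:X\to Y$ are $\Gamma$-equivariant and there is a $\Gamma$-equivariant lipschitz homotopy $H:(X\times[0,1],d_X\times d_{[0,1]})\to(Y,d_Y)$ (product distance) with $H(\cdot,0)=f_0$, $H(\cdot,1)=f_1$. A map $f$ is a $\Gamma$-lipschitz-homotopy equivalence if it is $\Gamma$-equivariant and lipschitz and there is a $\Gamma$-equivariant lipschitz map $g:Y\to X$ which is a homotopy inverse of $f$, with $f\circ g\sim_\Gamma\mathrm{id}_Y$ and $g\circ f\sim_\Gamma\mathrm{id}_X$. A map $f:X\to Y$ is uniformly proper if there is a continuous function $\alpha:[0,\infty)\to[0,\infty)$ such that $\mathrm{diam}(f^{-1}(A))\le\alpha(\mathrm{diam}(A))$ for every (bounded) subset $A\subseteq Y$. *)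

theory Defs
  imports "HOL-Analysis.Abstract_Metric_Spaces" "HOL-Algebra.Group_Action"
begin

definition equivariant ::
    "('g, 'm) monoid_scheme \<Rightarrow> 'a set \<Rightarrow> ('g \<Rightarrow> 'a \<Rightarrow> 'a) \<Rightarrow> 'b set \<Rightarrow> ('g \<Rightarrow> 'b \<Rightarrow> 'b) \<Rightarrow> ('a \<Rightarrow> 'b) \<Rightarrow> bool"
  where "equivariant \<Gamma> A \<phi> B \<psi> f \<longleftrightarrow>
    f \<in> A \<rightarrow> B \<and> (\<forall>\<gamma>\<in>carrier \<Gamma>. \<forall>x\<in>A. f (\<phi> \<gamma> x) = \<psi> \<gamma> (f x))"

abbreviation unit_interval_metric :: "real metric"
  where "unit_interval_metric \<equiv> submetric euclidean_metric {0..1}"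

definition lipschitz_homotopy ::
    "'a metric \<Rightarrow> 'b metric \<Rightarrow> ('a \<Rightarrow> 'b) \<Rightarrow> ('a \<Rightarrow> 'b) \<Rightarrow> ('a \<times> real \<Rightarrow> 'b) \<Rightarrow> bool"
  where "lipschitz_homotopy X Y f0 f1 H \<longleftrightarrow>
    Lipschitz_continuous_map (prod_metric X unit_interval_metric) Y H \<and>
    (\<forall>x\<in>mspace X. H (x, 0) = f0 x) \<and> (\<forall>x\<in>mspace X. H (x, 1) = f1 x)"

text \<open>The group acts trivially on the interval factor of the cylinder.\<close>

definition equivariantly_lipschitz_homotopic ::
    "('g, 'm) monoid_scheme \<Rightarrow> 'a metric \<Rightarrow> ('g \<Rightarrow> 'a \<Rightarrow> 'a) \<Rightarrow> 'b metric \<Rightarrow> ('g \<Rightarrow> 'b \<Rightarrow> 'b)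
      \<Rightarrow> ('a \<Rightarrow> 'b) \<Rightarrow> ('a \<Rightarrow> 'b) \<Rightarrow> bool"
  where "equivariantly_lipschitz_homotopic \<Gamma> X \<phi> Y \<psi> f0 f1 \<longleftrightarrow>
    equivariant \<Gamma> (mspace X) \<phi> (mspace Y) \<psi> f0 \<and>
    equivariant \<Gamma> (mspace X) \<phi> (mspace Y) \<psi> f1 \<and>
    (\<exists>H. lipschitz_homotopy X Y f0 f1 H \<and>
      equivariant \<Gamma> (mspace X \<times> {0..1}) (\<lambda>\<gamma> (x, t). (\<phi> \<gamma> x, t)) (mspace Y) \<psi> H)"

definition equivariant_lipschitz_homotopy_equivalence ::
    "('g, 'm) monoid_scheme \<Rightarrow> 'a metric \<Rightarrow> ('g \<Rightarrow> 'a \<Rightarrow> 'a) \<Rightarrow> 'b metric \<Rightarrow> ('g \<Rightarrow> 'b \<Rightarrow> 'b)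
      \<Rightarrow> ('a \<Rightarrow> 'b) \<Rightarrow> bool"
  where "equivariant_lipschitz_homotopy_equivalence \<Gamma> X \<phi> Y \<psi> f \<longleftrightarrow>
    equivariant \<Gamma> (mspace X) \<phi> (mspace Y) \<psi> f \<and> Lipschitz_continuous_map X Y f \<and>
    (\<exists>g. equivariant \<Gamma> (mspace Y) \<psi> (mspace X) \<phi> g \<and> Lipschitz_continuous_map Y X g \<and>
      equivariantly_lipschitz_homotopic \<Gamma> Y \<psi> Y \<psi> (f \<circ> g) id \<and>
      equivariantly_lipschitz_homotopic \<Gamma> X \<phi> X \<phi> (g \<circ> f) id)"

text \<open>No equivariance is demanded of the inverse or of the homotopies here.\<close>

definition lipschitz_homotopy_inverse ::
    "'a metric \<Rightarrow> 'b metric \<Rightarrow> ('a \<Rightarrow> 'b) \<Rightarrow> ('b \<Rightarrow> 'a) \<Rightarrow> bool"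
  where "lipschitz_homotopy_inverse X Y f g \<longleftrightarrow>
    Lipschitz_continuous_map Y X g \<and>
    (\<exists>K. lipschitz_homotopy Y Y (f \<circ> g) id K) \<and>
    (\<exists>H. lipschitz_homotopy X X (g \<circ> f) id H)"

text \<open>As with the library's \<^const>\<open>diameter\<close>, the value is meaningful only for bounded sets.\<close>

definition mdiameter :: "'a metric \<Rightarrow> 'a set \<Rightarrow> real"
  where "mdiameter X S = (if S = {} then 0 else SUP (x, y)\<in>S \<times> S. mdist X x y)"

text \<open>
  Since \<^const>\<open>Sup\<close> on the reals is unspecified for unbounded sets, the finiteness of the
  diameter of the preimage, implicit in the inequality, is stated separately.
\<close>

definition uniformly_proper :: "'a metric \<Rightarrow> 'b metric \<Rightarrow> ('a \<Rightarrow> 'b) \<Rightarrow> bool"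
  where "uniformly_proper X Y f \<longleftrightarrow>
    f \<in> mspace X \<rightarrow> mspace Y \<and>
    (\<exists>\<alpha> :: real \<Rightarrow> real. continuous_on {0..} \<alpha> \<and> \<alpha> \<in> {0..} \<rightarrow> {0..} \<and>
      (\<forall>A. A \<subseteq> mspace Y \<and> Metric_space.mbounded (mspace Y) (mdist Y) A \<longrightarrow>
        Metric_space.mbounded (mspace X) (mdist X) {x \<in> mspace X. f x \<in> A} \<and>
        mdiameter X {x \<in> mspace X. f x \<in> A} \<le> \<alpha> (mdiameter Y A)))"

end

theory Submission
  imports Defs
begin

text \<open>
  The homotopy from \<open>g \<circ> f\<close> to the identity moves each point along a path of parameter length 1,
  so \<open>g \<circ> f\<close> is within bounded distance of the identity. Going from \<open>x\<close> to \<open>y\<close> through \<open>g (f x)\<close>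
  and \<open>g (f y)\<close> therefore bounds \<open>d(x, y)\<close> by an affine function of \<open>d(f x, f y)\<close>.
\<close>

text \<open>Boundedness makes the set of distances bounded above; without that, the real
  \<open>Sup\<close> need not be an upper bound.\<close>

lemma mdist_le_mdiameter:
  assumes "Metric_space.mbounded (mspace X) (mdist X) S" "x \<in> S" "y \<in> S"
  shows "mdist X x y \<le> mdiameter X S"
proof -
  obtain B where B: "\<And>x y. x \<in> S \<Longrightarrow> y \<in> S \<Longrightarrow> mdist X x y \<le> B"
    using assms(1) by (auto simp: Metric_space.mbounded_alt[OF Metric_space_mspace_mdist])
  have "bdd_above ((\<lambda>(x, y). mdist X x y) ` (S \<times> S))"
    using B by (auto intro!: bdd_aboveI[where M = B])
  then have "(case (x, y) of (x, y) \<Rightarrow> mdist X x y) \<le> (SUP (x, y)\<in>S \<times> S. mdist X x y)"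
    using assms by (intro cSUP_upper) auto
  then show ?thesis
    using assms(2) by (auto simp: mdiameter_def)
qed

text \<open>The hypothesis \<open>0 \<le> B\<close> covers the empty set, whose diameter is 0 by
  convention.\<close>

lemma mdiameter_le:
  assumes "0 \<le> B" "\<And>x y. x \<in> S \<Longrightarrow> y \<in> S \<Longrightarrow> mdist X x y \<le> B"
  shows "mdiameter X S \<le> B"
  using assms by (auto simp: mdiameter_def intro!: cSUP_least)

text \<open>The affine bound on distances itself yields the control function: distances in the image
  are at most the diameter of \<open>A\<close>, and \<open>b\<close> is nonnegative.\<close>

lemma uniformly_proper_if_affine_bound:
  assumes f: "f \<in> mspace X \<rightarrow> mspace Y" and "0 \<le> a" "0 \<le> b"
    and ab: "\<And>x y. x \<in> mspace X \<Longrightarrow> y \<in> mspace X \<Longrightarrow> mdist X x y \<le> a + b * mdist Y (f x) (f y)"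
  shows "uniformly_proper X Y f"
  unfolding uniformly_proper_def
proof (intro conjI exI allI impI f)
  \<comment> \<open>With the absolute value, the nonnegativity of \<^term>\<open>mdiameter Y A\<close> need not be proved.\<close>
  let ?\<alpha> = "\<lambda>t. a + b * \<bar>t\<bar>"
  show "continuous_on {0..} ?\<alpha>"
    by (intro continuous_intros)
  show "?\<alpha> \<in> {0..} \<rightarrow> {0..}"
    using assms by auto
  fix A
  assume A: "A \<subseteq> mspace Y \<and> Metric_space.mbounded (mspace Y) (mdist Y) A"
  \<comment> \<open>This one pointwise bound gives both the boundedness of the preimage and the
    estimate of its diameter.\<close>
  have *: "mdist X x y \<le> ?\<alpha> (mdiameter Y A)"
    if "x \<in> {x \<in> mspace X. f x \<in> A}" "y \<in> {x \<in> mspace X. f x \<in> A}" for x y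
  proof -
    have "mdist Y (f x) (f y) \<le> \<bar>mdiameter Y A\<bar>"
      using mdist_le_mdiameter[of Y A "f x" "f y"] A that by auto
    then have "b * mdist Y (f x) (f y) \<le> b * \<bar>mdiameter Y A\<bar>"
      using \<open>0 \<le> b\<close> by (rule mult_left_mono)
    then show ?thesis
      using ab[of x y] that by auto
  qed
  show "Metric_space.mbounded (mspace X) (mdist X) {x \<in> mspace X. f x \<in> A}"
    unfolding Metric_space.mbounded_alt[OF Metric_space_mspace_mdist] using * by blast
  show "mdiameter X {x \<in> mspace X. f x \<in> A} \<le> ?\<alpha> (mdiameter Y A)"
    using assms * by (intro mdiameter_le) auto
qed

lemma lipschitz_homotopy_displacement:
  assumes "lipschitz_homotopy X Y f0 f1 H"
  obtains L where "0 < L" "\<And>x. x \<in> mspace X \<Longrightarrow> mdist Y (f0 x) (f1 x) \<le> L"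
proof -
  obtain L where "0 < L" and L: "\<And>p q. p \<in> mspace (prod_metric X unit_interval_metric) \<Longrightarrow>
      q \<in> mspace (prod_metric X unit_interval_metric) \<Longrightarrow>
      mdist Y (H p) (H q) \<le> L * mdist (prod_metric X unit_interval_metric) p q"
    using assms by (auto simp: lipschitz_homotopy_def Lipschitz_continuous_map_pos)
  have "mdist Y (f0 x) (f1 x) \<le> L" if "x \<in> mspace X" for x
  proof -
    have [simp]: "mdist X x x = 0"
      using mdist_zero[OF that that] by blast
    \<comment> \<open>The two ends of the segment over \<open>x\<close> have product distance
      \<open>sqrt (0^2 + 1^2) = 1\<close>, so the Lipschitz constant of \<open>H\<close> bounds the
      displacement, uniformly in \<open>x\<close>.\<close>
    have "mdist Y (H (x, 0)) (H (x, 1)) \<le> L"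
      using L[of "(x, 0)" "(x, 1)"] that by (simp add: prod_dist_def)
    then show ?thesis
      using assms that by (auto simp: lipschitz_homotopy_def)
  qed
  then show thesis
    using \<open>0 < L\<close> that by blast
qed

theorem lemma1p1p1:
  fixes \<Gamma> :: "('g, 'm) monoid_scheme"
    and X :: "'a metric" and \<phi> :: "'g \<Rightarrow> 'a \<Rightarrow> 'a"
    and Y :: "'b metric" and \<psi> :: "'g \<Rightarrow> 'b \<Rightarrow> 'b"
    and f :: "'a \<Rightarrow> 'b" and g :: "'b \<Rightarrow> 'a" and H :: "'a \<times> real \<Rightarrow> 'a"
  assumes "group \<Gamma>"
    and "group_action \<Gamma> (mspace X) \<phi>"
    and "group_action \<Gamma> (mspace Y) \<psi>"
    and "equivariant_lipschitz_homotopy_equivalence \<Gamma> X \<phi> Y \<psi> f"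
    and "lipschitz_homotopy_inverse X Y f g"
    and "lipschitz_homotopy X X (g \<circ> f) id H"
  shows "uniformly_proper X Y f"
proof -
  have f: "f \<in> mspace X \<rightarrow> mspace Y"
    using assms(4) by (simp add: equivariant_lipschitz_homotopy_equivalence_def equivariant_def)
  obtain M where g: "g \<in> mspace Y \<rightarrow> mspace X" and "0 < M"
    and M: "\<And>u v. u \<in> mspace Y \<Longrightarrow> v \<in> mspace Y \<Longrightarrow> mdist X (g u) (g v) \<le> M * mdist Y u v"
    using assms(5) by (auto simp: lipschitz_homotopy_inverse_def Lipschitz_continuous_map_pos)
  obtain L where "0 < L" and L: "\<And>x. x \<in> mspace X \<Longrightarrow> mdist X (g (f x)) x \<le> L"
    using lipschitz_homotopy_displacement[OF assms(6)] by auto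
  show ?thesis
  proof (rule uniformly_proper_if_affine_bound[OF f])
    \<comment> \<open>The displacement bound \<open>L\<close> is paid once at \<open>x\<close> and
      once at \<open>y\<close>; the slope \<open>M\<close> is the Lipschitz constant of
      \<open>g\<close>.\<close>
    show "0 \<le> 2 * L" "0 \<le> M"
      using \<open>0 < L\<close> \<open>0 < M\<close> by auto
    fix x y
    assume xy: "x \<in> mspace X" "y \<in> mspace X"
    then have fxy: "f x \<in> mspace Y" "f y \<in> mspace Y" "g (f x) \<in> mspace X" "g (f y) \<in> mspace X"
      using f g by auto
    have "mdist X x y \<le> mdist X x (g (f x)) + mdist X (g (f x)) y"
      using xy fxy by (intro mdist_triangle)
    also have "\<dots> \<le> mdist X (g (f x)) x + (mdist X (g (f x)) (g (f y)) + mdist X (g (f y)) y)"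
      using xy fxy mdist_triangle[of "g (f x)" X "g (f y)" y] by (simp add: mdist_commute)
    also have "\<dots> \<le> 2 * L + M * mdist Y (f x) (f y)"
      using L[of x] L[of y] M[of "f x" "f y"] xy fxy by auto
    finally show "mdist X x y \<le> 2 * L + M * mdist Y (f x) (f y)" .
  qed
qed

end
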